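(* Let $n\ge3$. The Lie subalgebras $\mathfrak{spe}(n)$, $\mathfrak{pe}(n)$, $\mathfrak{cspe}(n)$, $\mathfrak{cpe}(n)$, $\mathfrak{spe}(n)\rtimes\langle\tau+nz\rangle$ and $\mathfrak{spe}(n)\rtimes\langle a\tau+bz\rangle$ (where $a,b\in\mathbb C$, $\frac ba\ne n$) of $\mathfrak{gl}(n|n)$ are Berger superalgebras.
   Context: Everything is over $\mathbb C$. $\mathfrak{pe}(n)\subset\mathfrak{gl}(n|n)$ is the periplectic Lie superalgebra, i.e. the supersubalgebra annihilating an odd non-degenerate supersymmetric bilinear form on $\mathbb C^{n|n}$; in a suitable basis it consists of the matrices $\begin{pmatrix}A&B\\C&-A^t\end{pmatrix}$ with $B=B^t$, $C=-C^t$. $\mathfrak{spe}(n)=\{\mathrm{tr}A=0\}\subset\mathfrak{pe}(n)$. $\tau=\mathrm{diag}(1_n,-1_n)$, $z=1_{2n}$; $\mathfrak{cspe}(n)=\mathfrak{spe}(n)\oplus\mathbb Cz$, $\mathfrak{cpe}(n)=\mathfrak{pe}(n)\oplus\mathbb Cz$. $\langle\cdot\rangle$ denotes the linear span. Berger superalgebra: for a supersubalgebra $\mathfrak g\subset\mathfrak{gl}(V)$ let $\mathcal R(\mathfrak g)$ be the vector superspace of bilinear maps $R:V\times V\to\mathfrak g$ with $R(X,Y)=-(-1)^{|X||Y|}R(Y,X)$ and $R(X,Y)Z+(-1)^{|X|(|Y|+|Z|)}R(Y,Z)X+(-1)^{|Z|(|X|+|Y|)}R(Z,X)Y=0$ for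 homogeneous $X,Y,Z\in V$ ($|\cdot|$ is the parity). Put $L(\mathcal R(\mathfrak g))=\mathrm{span}\{R(X,Y)\mid R\in\mathcal R(\mathfrak g),X,Y\in V\}$. $\mathfrak g$ is a Berger superalgebra if $L(\mathcal R(\mathfrak g))=\mathfrak g$. Here $V=\mathbb C^{n|n}$. *)

theory Defs
  imports "HOL-Analysis.Analysis"
begin

text \<open>
  The superspace with even and odd dimension both equal to \<open>n = CARD('n)\<close>: coordinates
  indexed by \<open>Inl\<close> are even, those indexed by \<open>Inr\<close> are odd.  A parity is an
  element of \<open>{0, 1} :: nat set\<close>.
\<close>

type_synonym 'n sspace = "complex ^ ('n + 'n)"
type_synonym 'n gl = "complex ^ ('n + 'n) ^ ('n + 'n)"

fun par :: "'n + 'n \<Rightarrow> nat" where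
  "par (Inl _) = 0"
| "par (Inr _) = 1"

text \<open>The zero vector is homogeneous of both parities.\<close>

definition homogeneous :: "nat \<Rightarrow> 'n::finite sspace \<Rightarrow> bool" where
  "homogeneous p x \<longleftrightarrow> (\<forall>i. par i \<noteq> p \<longrightarrow> x $ i = 0)"

definition parity_part :: "nat \<Rightarrow> 'n::finite gl \<Rightarrow> 'n gl" where
  "parity_part p M = (\<chi> i j. if (par i + par j) mod 2 = p then M $ i $ j else 0)"

definition cscale :: "complex \<Rightarrow> complex ^ 'n ^ 'm \<Rightarrow> complex ^ 'n ^ 'm" (infixr "*\<^sub>C" 75)
  where "c *\<^sub>C M = map_matrix (\<lambda>a. c * a) M"

interpretation cmat: vector_space "cscale :: complex \<Rightarrow> complex ^ 'n ^ 'm \<Rightarrow> complex ^ 'n ^ 'm"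
  by standard (simp_all add: cscale_def map_matrix_def vec_eq_iff algebra_simps)

text \<open>The supercommutator, extended bilinearly from homogeneous matrices.\<close>

definition sbracket :: "'n::finite gl \<Rightarrow> 'n gl \<Rightarrow> 'n gl" where
  "sbracket M N =
     (\<Sum>p\<in>{0, 1}. \<Sum>q\<in>{0, 1}.
        parity_part p M ** parity_part q N - (-1) ^ (p * q) *\<^sub>C (parity_part q N ** parity_part p M))"

definition supersubalgebra :: "'n::finite gl set \<Rightarrow> bool" where
  "supersubalgebra g \<longleftrightarrow>
     cmat.subspace g \<and>
     (\<forall>M\<in>g. \<forall>p\<in>{0, 1}. parity_part p M \<in> g) \<and>
     (\<forall>M\<in>g. \<forall>N\<in>g. sbracket M N \<in> g)"


text \<open>
  The maps in \<open>curvature_maps g\<close> are not required to be homogeneous: both conditions are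
  linear in \<open>R\<close> and involve only the parities of the arguments, so this is the whole
  vector superspace.
\<close>

definition bilinear_map :: "('n::finite sspace \<Rightarrow> 'n sspace \<Rightarrow> 'n gl) \<Rightarrow> bool" where
  "bilinear_map R \<longleftrightarrow>
     (\<forall>X. Vector_Spaces.linear (*s) (*\<^sub>C) (\<lambda>Y. R X Y)) \<and>
     (\<forall>Y. Vector_Spaces.linear (*s) (*\<^sub>C) (\<lambda>X. R X Y))"

definition curvature_maps :: "'n::finite gl set \<Rightarrow> ('n sspace \<Rightarrow> 'n sspace \<Rightarrow> 'n gl) set" where
  "curvature_maps g = {R.
     bilinear_map R \<and> (\<forall>X Y. R X Y \<in> g) \<and>
     (\<forall>p\<in>{0, 1}. \<forall>q\<in>{0, 1}. \<forall>X Y. homogeneous p X \<longrightarrow> homogeneous q Y \<longrightarrow>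
        R X Y = - ((-1) ^ (p * q) *\<^sub>C R Y X)) \<and>
     (\<forall>p\<in>{0, 1}. \<forall>q\<in>{0, 1}. \<forall>r\<in>{0, 1}. \<forall>X Y Z.
        homogeneous p X \<longrightarrow> homogeneous q Y \<longrightarrow> homogeneous r Z \<longrightarrow>
        R X Y *v Z + (-1) ^ (p * (q + r)) *s (R Y Z *v X)
          + (-1) ^ (r * (p + q)) *s (R Z X *v Y) = 0)}"

definition curvature_span :: "'n::finite gl set \<Rightarrow> 'n gl set" where
  "curvature_span g = cmat.span {R X Y | R X Y. R \<in> curvature_maps g}"

definition berger :: "'n::finite gl set \<Rightarrow> bool" where
  "berger g \<longleftrightarrow> supersubalgebra g \<and> curvature_span g = g"


text \<open>The standard odd non-degenerate supersymmetric form.\<close>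

definition odd_form :: "'n::finite sspace \<Rightarrow> 'n sspace \<Rightarrow> complex" where
  "odd_form x y = (\<Sum>i\<in>UNIV. x $ Inl i * y $ Inr i + x $ Inr i * y $ Inl i)"

text \<open>
  A homogeneous \<open>M\<close> annihilates the form \<open>b\<close> if \<open>b(Mx, y) + (-1)^(|M||x|) b(x, My) = 0\<close>;
  a general \<open>M\<close> does if both of its homogeneous parts do.
\<close>

definition pe :: "'n::finite gl set" where
  "pe = {M. \<forall>p\<in>{0, 1}. \<forall>q\<in>{0, 1}. \<forall>x y. homogeneous q x \<longrightarrow>
     odd_form (parity_part p M *v x) y + (-1) ^ (p * q) * odd_form x (parity_part p M *v y) = 0}"

definition spe :: "'n::finite gl set" where
  "spe = {M \<in> pe. trace (\<chi> i j. M $ Inl i $ Inl j) = 0}"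

definition tau :: "'n::finite gl" where
  "tau = (\<chi> i j. if i = j then (-1) ^ par i else 0)"

abbreviation zed :: "'n::finite gl" where
  "zed \<equiv> mat 1"

text \<open>
  The subspace \<open>g + \<langle>M\<rangle>\<close> of the general linear superalgebra.  In all uses below the sum is
  direct and \<open>M\<close> normalises \<open>g\<close>, so it is the (semi-)direct sum of \<open>g\<close> with the line
  spanned by \<open>M\<close>; see \<open>zed_notin_pe\<close>, \<open>tau_zed_notin_spe\<close> and \<open>sbracket_tau_zed\<close>.
\<close>

definition extend_by :: "'n::finite gl set \<Rightarrow> 'n gl \<Rightarrow> 'n gl set" where
  "extend_by g M = {X + Y | X Y. X \<in> g \<and> Y \<in> cmat.span {M}}"

definition cspe :: "'n::finite gl set" where
  "cspe = extend_by spe zed"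

definition cpe :: "'n::finite gl set" where
  "cpe = extend_by pe zed"


lemma odd_form_supersymmetric: "odd_form x y = odd_form y x"
  by (simp add: odd_form_def algebra_simps)

lemma odd_form_odd:
  assumes "homogeneous p x" "homogeneous p y" "p \<in> {0, 1}"
  shows "odd_form x y = 0"
  using assms by (auto simp: odd_form_def homogeneous_def)

lemma sum_UNIV_sum:
  fixes f :: "'a::finite + 'a \<Rightarrow> complex"
  shows "(\<Sum>k\<in>UNIV. f k) = (\<Sum>i\<in>UNIV. f (Inl i)) + (\<Sum>i\<in>UNIV. f (Inr i))"
  unfolding UNIV_sum by (subst sum.union_disjoint) (auto simp: sum.reindex)

lemma odd_form_axis:
  "odd_form x (axis (Inr i) 1) = x $ Inl i"
  "odd_form x (axis (Inl i) 1) = x $ Inr i"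
  "odd_form (axis (Inr i) 1) x = x $ Inl i"
  "odd_form (axis (Inl i) 1) x = x $ Inr i"
  by (simp_all add: odd_form_def axis_def if_distrib[of "\<lambda>c. _ * c"]
      if_distrib[of "\<lambda>c. c * _"] cong: if_cong)

lemma odd_form_nondegenerate:
  assumes "\<And>y. odd_form x y = 0"
  shows "x = 0"
proof -
  have "x $ k = 0" for k
    using assms[of "axis (Inr _) 1"] assms[of "axis (Inl _) 1"]
    by (cases k) (simp_all add: odd_form_axis)
  then show ?thesis by (simp add: vec_eq_iff)
qed

text \<open>
  The block form \<open>(A, B; C, -A\<^sup>t)\<close> with \<open>B\<close> symmetric and \<open>C\<close> skew-symmetric.
\<close>

lemma mem_pe_iff:
  "M \<in> pe \<longleftrightarrow> (\<forall>i j. M $ Inr i $ Inr j = - M $ Inl j $ Inl i \<and>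
     M $ Inl i $ Inr j = M $ Inl j $ Inr i \<and> M $ Inr i $ Inl j = - M $ Inr j $ Inl i)"
  (is "_ \<longleftrightarrow> (\<forall>i j. ?D i j \<and> ?B i j \<and> ?C i j)")
proof
  assume M: "M \<in> pe"
  have mem: "odd_form (parity_part p M *v x) y + (-1) ^ (p * q) * odd_form x (parity_part p M *v y) = 0"
    if "p \<in> {0, 1}" "q \<in> {0, 1}" "homogeneous q x" for p q x y
    using M that unfolding pe_def by blast
  have hom: "homogeneous 0 (axis (Inl i) 1)" "homogeneous 1 (axis (Inr i) 1)" for i :: 'a
    by (auto simp: homogeneous_def axis_def)
  have col: "(N *v axis k 1) $ i = N $ i $ k" for N :: "'a gl" and i k
    by (simp add: matrix_vector_mult_def axis_def if_distrib[of "\<lambda>c. _ * c"] cong: if_cong)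
  have "?D i j" for i j
    using mem[OF _ _ hom(2)[of j], of 0 "axis (Inl i) 1"]
    by (simp add: odd_form_axis col parity_part_def add_eq_0_iff)
  moreover have "?B i j" for i j
    using mem[OF _ _ hom(2)[of j], of 1 "axis (Inr i) 1"]
    by (simp add: odd_form_axis col parity_part_def)
  moreover have "?C i j" for i j
    using mem[OF _ _ hom(1)[of j], of 1 "axis (Inl i) 1"]
    by (simp add: odd_form_axis col parity_part_def add_eq_0_iff)
  ultimately show "\<forall>i j. ?D i j \<and> ?B i j \<and> ?C i j" by blast
next
  assume R: "\<forall>i j. ?D i j \<and> ?B i j \<and> ?C i j"
  then have D: "M $ Inr i $ Inr j = - M $ Inl j $ Inl i" and
    C: "M $ Inr i $ Inl j = - M $ Inr j $ Inl i" and
    B: "M $ Inl i $ Inr j = M $ Inl j $ Inr i" for i j by blast+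
  have adj: "(\<Sum>i\<in>UNIV. (\<Sum>j\<in>UNIV. P i j * u j) * v i)
      = (\<Sum>i\<in>UNIV. u i * (\<Sum>j\<in>UNIV. P j i * v j))"
    for P :: "'a \<Rightarrow> 'a \<Rightarrow> complex" and u v
    unfolding sum_distrib_left sum_distrib_right
    by (subst sum.swap) (simp add: mult_ac)
  have "odd_form (parity_part p M *v x) y + (-1) ^ (p * q) * odd_form x (parity_part p M *v y) = 0"
    if pq: "p \<in> {0, 1}" "q \<in> {0, 1}" and "homogeneous q x" for p q x y
  proof -
    have x0: "x $ Inr i = 0" if "q = 0" for i
      using \<open>homogeneous q x\<close> that by (auto simp: homogeneous_def)
    have x1: "x $ Inl i = 0" if "q = 1" for i
      using \<open>homogeneous q x\<close> that by (auto simp: homogeneous_def)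
    consider "p = 0" "q = 0" | "p = 0" "q = 1" | "p = 1" "q = 0" | "p = 1" "q = 1"
      using pq by blast
    then show ?thesis
    proof cases
      case 1
      show ?thesis
        by (simp add: odd_form_def matrix_vector_mult_def sum_UNIV_sum parity_part_def x0 1
            adj D sum_negf)
    next
      case 2
      show ?thesis
        by (simp add: odd_form_def matrix_vector_mult_def sum_UNIV_sum parity_part_def x1 2
            adj D sum_negf)
    next
      case 3
      show ?thesis
        by (simp add: odd_form_def matrix_vector_mult_def sum_UNIV_sum parity_part_def x0 3
            adj)
           (subst C, simp add: sum_negf)
    next
      case 4
      show ?thesis
        by (simp add: odd_form_def matrix_vector_mult_def sum_UNIV_sum parity_part_def x1 4
            adj)
           (subst B, simp)
    qed
  qed
  then show "M \<in> pe" unfolding pe_def by blast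
qed

lemma zed_notin_pe: "zed \<notin> (pe :: 'n::finite gl set)"
  by (auto simp: mem_pe_iff mat_def)

lemma tau_zed_notin_spe:
  assumes "a \<noteq> 0 \<or> b \<noteq> 0"
  shows "a *\<^sub>C tau + b *\<^sub>C zed \<notin> (spe :: 'n::finite gl set)"
  using assms
  by (auto simp: spe_def mem_pe_iff trace_def tau_def mat_def cscale_def)

lemma sbracket_tau_zed:
  assumes "M \<in> pe"
  shows "sbracket (a *\<^sub>C tau + b *\<^sub>C zed) M \<in> spe"
proof -
  define t :: "'a + 'a \<Rightarrow> complex" where "t i = a * (-1) ^ par i + b" for i
  define T :: "'a gl" where "T = a *\<^sub>C tau + b *\<^sub>C zed"
  have T: "T $ i $ j = (if i = j then t i else 0)" for i j
    by (simp add: T_def t_def tau_def mat_def cscale_def)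
  have T0: "parity_part 0 T = T" and T1: "parity_part 1 T = 0"
    by (auto simp: parity_part_def vec_eq_iff T simp flip: mult_2)
  have mult: "(T ** N) $ i $ j = t i * N $ i $ j" "(N ** T) $ i $ j = N $ i $ j * t j" for N i j
    by (simp_all add: matrix_matrix_mult_def T if_distrib[of "\<lambda>c. _ * c"]
        if_distrib[of "\<lambda>c. c * _"] cong: if_cong)
  have parts: "parity_part 0 M $ i $ j + parity_part 1 M $ i $ j = M $ i $ j" for i j
    by (auto simp: parity_part_def)
  have eq: "sbracket T M = (T ** parity_part 0 M - parity_part 0 M ** T)
      + (T ** parity_part 1 M - parity_part 1 M ** T)"
    unfolding sbracket_def T0
    by (simp add: T0 T1[simplified])
  have "sbracket T M $ i $ j
      = (t i - t j) * (parity_part 0 M $ i $ j + parity_part 1 M $ i $ j)" for i j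
    unfolding eq vector_add_component vector_minus_component mult
    by (simp add: algebra_simps)
  then have br: "sbracket T M $ i $ j = (t i - t j) * M $ i $ j" for i j
    unfolding parts .
  have B: "M $ Inl i $ Inr j = M $ Inl j $ Inr i"
    and C: "M $ Inr i $ Inl j = - M $ Inr j $ Inl i" for i j
    using assms unfolding mem_pe_iff by blast+
  have t: "t (Inl i) = a + b" "t (Inr i) = b - a" for i
    by (simp_all add: t_def)
  have "sbracket T M \<in> pe"
    unfolding mem_pe_iff br t
  proof (intro allI conjI)
    fix i j
    show "(a + b - (b - a)) * M $ Inl i $ Inr j = (a + b - (b - a)) * M $ Inl j $ Inr i"
      by (subst B) (rule refl)
    show "(b - a - (a + b)) * M $ Inr i $ Inl j = - ((b - a - (a + b)) * M $ Inr j $ Inl i)"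
      by (subst C) (rule mult_minus_right)
  qed simp
  moreover have "trace (\<chi> i j. sbracket T M $ Inl i $ Inl j) = 0"
    by (simp add: trace_def br t)
  ultimately show ?thesis
    unfolding spe_def T_def by blast
qed

end

theory Submission
  imports Defs
begin

text \<open>
  Write \<open>e\<^sub>i\<close> for the even and \<open>f\<^sub>i\<close> for the odd basis vectors.  All six superalgebras are linear
  subspaces lying between \<open>spe\<close> and \<open>cpe\<close>, and the theorem holds for every such subspace \<open>g\<close>
  (lemma \<open>berger_between\<close>).  Such a \<open>g\<close> is a supersubalgebra because the supercommutator of two
  elements of \<open>cpe\<close> already lies in \<open>spe\<close>: the centre drops out, and the upper left block is a
  commutator plus products of a symmetric with a skew-symmetric matrix, all of trace zero.

  It remains to find enough curvature maps.  A curvature map is given by its values \<open>R(b\<^sub>i, b\<^sub>j)\<close> on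
  basis vectors, subject to membership in \<open>g\<close>, super skew-symmetry and the Bianchi identity
  (lemma \<open>tensor_map_in_curvature_maps\<close>).  The odd form identifies \<open>pe\<close> with a second exterior
  power of the dual of \<open>V\<close>, up to parity, just as a metric does for an orthogonal algebra, so
  the maps for \<open>pe\<close> are super analogues of Riemann tensors.  Three families suffice.

  \<^item> The square \<open>w \<otimes> w\<close> of a decomposable two-form \<open>w = e\<^sup>p \<and> e\<^sup>q\<close> satisfies the Bianchi identity by
    the Pluecker relation, and yields the skew-symmetric lower left blocks.

  \<^item> For a skew-symmetric \<open>w\<close>, the tensor \<open>w\<^sub>i\<^sub>k w\<^sub>j\<^sub>l + w\<^sub>i\<^sub>l w\<^sub>j\<^sub>k\<close> is its counterpart on the odd
    vectors, where the two arguments of a curvature map commute; it yields the symmetric upper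
    right blocks.

  \<^item> Let \<open>M = diag(A, -A\<^sup>t + 2c)\<close> be any even element of \<open>g\<close> and let \<open>p \<noteq> q\<close>.  There is a curvature
    map of \<open>g\<close> with \<open>R(e\<^sub>p, e\<^sub>q) = M\<close>.  On three even vectors the Bianchi identity only concerns the
    upper left blocks, and it is satisfied by choosing, for the other indices \<open>k\<close>, the vectors
    \<open>R(e\<^sub>q, e\<^sub>k) e\<^sub>p\<close> and \<open>R(e\<^sub>k, e\<^sub>p) e\<^sub>q\<close> with sum \<open>- A e\<^sub>k\<close>.  The first is taken
    along \<open>e\<^sub>q\<close> and the second without \<open>e\<^sub>q\<close> component, so that these corrections are traceless and every \<open>R(e\<^sub>i, e\<^sub>j)\<close> lies in \<open>spe + \<langle>M\<rangle>\<close>.  On two even vectors and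
    an odd one the identity reads \<open>K\<^sub>j\<^sub>k\<^sub>i - K\<^sub>i\<^sub>k\<^sub>j = F\<^sub>i\<^sub>j\<^sub>k\<close>, where \<open>F\<close> is given, skew in \<open>i\<close>, \<open>j\<close>, and
    \<open>K\<close> must be skew in its last two indices, as \<open>R(e\<^sub>j, f\<^sub>l)\<close> is a lower left block.  It has a unique
    solution, by the computation that produces the Levi-Civita connection.

  The last family exists for every value of \<open>tr A\<close> and \<open>c\<close>; it therefore treats all six
  superalgebras at once.
\<close>

section \<open>Block matrices\<close>

definition blocks ::
  "('n \<Rightarrow> 'n \<Rightarrow> complex) \<Rightarrow> ('n \<Rightarrow> 'n \<Rightarrow> complex) \<Rightarrow> ('n \<Rightarrow> 'n \<Rightarrow> complex) \<Rightarrow> ('n \<Rightarrow> 'n \<Rightarrow> complex)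
    \<Rightarrow> 'n::finite gl" where
  "blocks A B C D = (\<chi> r c. case r of
      Inl i \<Rightarrow> (case c of Inl j \<Rightarrow> A i j | Inr j \<Rightarrow> B i j)
    | Inr i \<Rightarrow> (case c of Inl j \<Rightarrow> C i j | Inr j \<Rightarrow> D i j))"

abbreviation "diagonal_blocks A D \<equiv> blocks A (\<lambda>_ _. 0) (\<lambda>_ _. 0) D"
abbreviation "upper_block B \<equiv> blocks (\<lambda>_ _. 0) B (\<lambda>_ _. 0) (\<lambda>_ _. 0)"
abbreviation "lower_block C \<equiv> blocks (\<lambda>_ _. 0) (\<lambda>_ _. 0) C (\<lambda>_ _. 0)"

lemma blocks_nth [simp]:
  "blocks A B C D $ Inl i $ Inl j = A i j"
  "blocks A B C D $ Inl i $ Inr j = B i j"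
  "blocks A B C D $ Inr i $ Inl j = C i j"
  "blocks A B C D $ Inr i $ Inr j = D i j"
  by (simp_all add: blocks_def)

lemma cscale_nth [simp]: "(c *\<^sub>C M) $ i $ j = c * M $ i $ j"
  by (simp add: cscale_def map_matrix_def)

lemma gl_eqI:
  fixes M N :: "'n::finite gl"
  assumes "\<And>i j. M $ Inl i $ Inl j = N $ Inl i $ Inl j"
    "\<And>i j. M $ Inl i $ Inr j = N $ Inl i $ Inr j"
    "\<And>i j. M $ Inr i $ Inl j = N $ Inr i $ Inl j"
    "\<And>i j. M $ Inr i $ Inr j = N $ Inr i $ Inr j"
  shows "M = N"
proof -
  have "M $ r $ c = N $ r $ c" for r c
    by (cases r; cases c) (simp_all add: assms)
  then show ?thesis by (simp add: vec_eq_iff)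
qed

section \<open>The spaces between spe and cpe\<close>

lemma mem_spe_iff:
  "M \<in> spe \<longleftrightarrow> M \<in> pe \<and> (\<Sum>i\<in>UNIV. M $ Inl i $ Inl i) = 0"
  by (simp add: spe_def trace_def)

lemma pe_entries:
  assumes "M \<in> pe"
  shows "M $ Inr i $ Inr j = - M $ Inl j $ Inl i"
    and "M $ Inl i $ Inr j = M $ Inl j $ Inr i"
    and "M $ Inr i $ Inl j = - M $ Inr j $ Inl i"
  using assms unfolding mem_pe_iff by blast+

lemma subspace_pe: "cmat.subspace (pe :: 'n::finite gl set)"
proof -
  have "X + Y \<in> pe" if "X \<in> pe" "Y \<in> pe" for X Y :: "'n gl"
    unfolding mem_pe_iff
  proof (intro allI)
    fix i j
    show "(X + Y) $ Inr i $ Inr j = - (X + Y) $ Inl j $ Inl i \<and>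
        (X + Y) $ Inl i $ Inr j = (X + Y) $ Inl j $ Inr i \<and>
        (X + Y) $ Inr i $ Inl j = - (X + Y) $ Inr j $ Inl i"
      using pe_entries[OF that(1), of i j] pe_entries[OF that(2), of i j] by simp
  qed
  moreover have "c *\<^sub>C X \<in> pe" if "X \<in> pe" for c and X :: "'n gl"
    unfolding mem_pe_iff
  proof (intro allI)
    fix i j
    show "(c *\<^sub>C X) $ Inr i $ Inr j = - (c *\<^sub>C X) $ Inl j $ Inl i \<and>
        (c *\<^sub>C X) $ Inl i $ Inr j = (c *\<^sub>C X) $ Inl j $ Inr i \<and>
        (c *\<^sub>C X) $ Inr i $ Inl j = - (c *\<^sub>C X) $ Inr j $ Inl i"
      using pe_entries[OF that, of i j] by simp
  qed
  moreover have "0 \<in> (pe :: 'n gl set)" by (simp add: mem_pe_iff)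
  ultimately show ?thesis
    unfolding cmat.subspace_def by blast
qed

lemma subspace_spe: "cmat.subspace (spe :: 'n::finite gl set)"
  using subspace_pe
  by (auto simp: cmat.subspace_def mem_spe_iff sum.distrib simp flip: sum_distrib_left)

lemma spe_subset_pe: "spe \<subseteq> pe"
  by (simp add: spe_def)

lemma mem_extend_by: "X \<in> extend_by g M \<longleftrightarrow> (\<exists>Y\<in>g. \<exists>c. X = Y + c *\<^sub>C M)"
  by (auto simp: extend_by_def cmat.span_singleton)

lemma subset_extend_by: "g \<subseteq> extend_by g M"
proof
  fix X assume "X \<in> g"
  then have "X = X + 0 *\<^sub>C M" "X \<in> g" by simp_all
  then show "X \<in> extend_by g M" unfolding mem_extend_by by blast
qed

lemma subspace_extend_by:
  assumes "cmat.subspace g"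
  shows "cmat.subspace (extend_by g M)"
proof -
  have "extend_by g M = {X + Y | X Y. X \<in> g \<and> Y \<in> cmat.span {M}}"
    by (simp add: extend_by_def)
  then show ?thesis
    using cmat.subspace_sums[OF assms cmat.subspace_span, of "{M}"] by simp
qed

lemma mem_cpe_blocks:
  assumes "M \<in> cpe"
  obtains c where
    "\<And>i j. M $ Inr i $ Inr j = - M $ Inl j $ Inl i + (if i = j then 2 * c else 0)"
    "\<And>i j. M $ Inl i $ Inr j = M $ Inl j $ Inr i"
    "\<And>i j. M $ Inr i $ Inl j = - M $ Inr j $ Inl i"
proof -
  obtain X c where X: "X \<in> pe" and M: "M = X + c *\<^sub>C zed"
    using assms by (auto simp: cpe_def mem_extend_by)
  note D = pe_entries(1)[OF X] and B = pe_entries(2)[OF X] and C = pe_entries(3)[OF X]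
  show thesis
  proof (rule that[of c])
    show "M $ Inr i $ Inr j = - M $ Inl j $ Inl i + (if i = j then 2 * c else 0)" for i j
      by (simp add: M mat_def D)
    show "M $ Inl i $ Inr j = M $ Inl j $ Inr i" for i j
      using B[of i j] by (simp add: M mat_def)
    show "M $ Inr i $ Inl j = - M $ Inr j $ Inl i" for i j
      using C[of i j] by (simp add: M mat_def)
  qed
qed

text \<open>
  The entry \<open>(i, k)\<close> of a matrix belongs to the part of parity \<open>|i| + |k|\<close>, so the sum over the
  four combinations of parities collapses to a sign depending on the entries multiplied.
\<close>

lemma sbracket_nth:
  "sbracket M N $ i $ j = (\<Sum>k\<in>UNIV. M $ i $ k * N $ k $ j
     - (-1) ^ ((par i + par k) * (par k + par j)) * (N $ i $ k * M $ k $ j))"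
proof -
  have "sbracket M N $ i $ j = (\<Sum>k\<in>UNIV. \<Sum>p\<in>{0, 1}. \<Sum>q\<in>{0, 1}.
      parity_part p M $ i $ k * parity_part q N $ k $ j
      - (-1) ^ (p * q) * (parity_part q N $ i $ k * parity_part p M $ k $ j))"
    by (simp add: sbracket_def matrix_matrix_mult_def sum_distrib_left sum.distrib
        sum_subtractf sum_negf)
  also have "\<dots> = (\<Sum>k\<in>UNIV. M $ i $ k * N $ k $ j
     - (-1) ^ ((par i + par k) * (par k + par j)) * (N $ i $ k * M $ k $ j))"
  proof (rule sum.cong[OF refl])
    fix k
    show "(\<Sum>p\<in>{0, 1}. \<Sum>q\<in>{0, 1}.
        parity_part p M $ i $ k * parity_part q N $ k $ j
        - (-1) ^ (p * q) * (parity_part q N $ i $ k * parity_part p M $ k $ j))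
      = M $ i $ k * N $ k $ j
        - (-1) ^ ((par i + par k) * (par k + par j)) * (N $ i $ k * M $ k $ j)"
      by (cases i; cases j; cases k) (simp_all add: parity_part_def)
  qed
  finally show ?thesis .
qed

text \<open>
  The scalar matrices are even and hence commute, without signs, with everything.
\<close>

lemma sbracket_add_zed:
  fixes M N :: "'a::finite gl"
  shows "sbracket (M + c *\<^sub>C zed) (N + d *\<^sub>C zed) = sbracket M N"
proof -
  have "sbracket (M + c *\<^sub>C zed) (N + d *\<^sub>C zed) $ i $ j = sbracket M N $ i $ j" for i j
  proof -
    define s :: "'a + 'a \<Rightarrow> complex" where "s k = ((-1) ^ ((par i + par k) * (par k + par j)) :: complex)" for k
    have s: "s i = 1" "s j = 1"
      by (cases i; cases j; simp add: s_def)+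
    have sums: "(\<Sum>k\<in>UNIV. f k * (if k = j then x else 0)) = f j * x"
      "(\<Sum>k\<in>UNIV. f k * (if i = k then x else 0)) = f i * x" for f :: "'a + 'a \<Rightarrow> complex" and x
      by (simp_all add: if_distrib[of "\<lambda>c. _ * c"] cong: if_cong)
    have "sbracket (M + c *\<^sub>C zed) (N + d *\<^sub>C zed) $ i $ j - sbracket M N $ i $ j
      = (\<Sum>k\<in>UNIV. M $ i $ k * (if k = j then d else 0))
      + (\<Sum>k\<in>UNIV. (N + d *\<^sub>C zed) $ k $ j * (if i = k then c else 0))
      - (\<Sum>k\<in>UNIV. (s k * N $ i $ k) * (if k = j then c else 0))
      - (\<Sum>k\<in>UNIV. (s k * (M + c *\<^sub>C zed) $ k $ j) * (if i = k then d else 0))"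
      unfolding sbracket_nth s_def[symmetric] sum.distrib[symmetric] sum_subtractf[symmetric]
      by (rule sum.cong[OF refl]) (auto simp: mat_def algebra_simps)
    also have "\<dots> = 0"
      unfolding sums s by (auto simp: mat_def algebra_simps)
    finally show ?thesis by simp
  qed
  then show ?thesis by (simp add: vec_eq_iff)
qed

lemma sum_symmetric_skew_eq_0:
  fixes B C :: "'a::finite \<Rightarrow> 'a \<Rightarrow> complex"
  assumes "\<And>i j. B i j = B j i" "\<And>i j. C i j = - C j i"
  shows "(\<Sum>i\<in>UNIV. \<Sum>k\<in>UNIV. B i k * C k i) = 0"
proof -
  have "(\<Sum>i\<in>UNIV. \<Sum>k\<in>UNIV. B i k * C k i) = (\<Sum>i\<in>UNIV. \<Sum>k\<in>UNIV. B k i * C i k)"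
    by (rule sum.swap)
  also have "\<dots> = - (\<Sum>i\<in>UNIV. \<Sum>k\<in>UNIV. B i k * C k i)"
    unfolding sum_negf[symmetric] using assms by (intro sum.cong refl) (metis mult_minus_right)
  finally show ?thesis by simp
qed

text \<open>
  For the trace, the upper left block of the supercommutator is
  \<open>[A, A'] + B C' + B' C\<close>, where \<open>B\<close>, \<open>B'\<close> are symmetric and \<open>C\<close>, \<open>C'\<close> skew-symmetric.
\<close>

lemma sbracket_pe_in_spe:
  assumes "M \<in> pe" "N \<in> pe"
  shows "sbracket M N \<in> spe"
proof -
  have D: "X $ Inr i $ Inr j = - X $ Inl j $ Inl i"
    and B: "X $ Inl i $ Inr j = X $ Inl j $ Inr i"
    and C: "X $ Inr i $ Inl j = - X $ Inr j $ Inl i" if "X \<in> {M, N}" for X i j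
    using that assms pe_entries by blast+
  note D' = D[of M] D[of N] and B' = B[of M] B[of N] and C' = C[of M] C[of N]
  define t where "t i j k = M $ i $ k * N $ k $ j
     - (-1) ^ ((par i + par k) * (par k + par j)) * (N $ i $ k * M $ k $ j)" for i j k
  have br: "sbracket M N $ i $ j = (\<Sum>k\<in>UNIV. t i j (Inl k) + t i j (Inr k))" for i j
    by (simp add: sbracket_nth sum_UNIV_sum sum.distrib t_def)
  have "t (Inr i) (Inr j) (Inl k) + t (Inr i) (Inr j) (Inr k)
      = - (t (Inl j) (Inl i) (Inl k) + t (Inl j) (Inl i) (Inr k))" for i j k
    by (simp add: t_def D' B'[of k j] C'[of i k])
  then have "sbracket M N $ Inr i $ Inr j = - sbracket M N $ Inl j $ Inl i" for i j
    unfolding br sum_negf[symmetric] by (simp only:)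
  moreover have "t (Inl i) (Inr j) (Inl k) + t (Inl i) (Inr j) (Inr k)
      = t (Inl j) (Inr i) (Inl k) + t (Inl j) (Inr i) (Inr k)" for i j k
    by (simp add: t_def D' B'[of k j] B'[of k i])
  then have "sbracket M N $ Inl i $ Inr j = sbracket M N $ Inl j $ Inr i" for i j
    unfolding br by simp
  moreover have CA: "t (Inr i) (Inl j) (Inl k) + t (Inr i) (Inl j) (Inr k)
      = - (t (Inr j) (Inl i) (Inl k) + t (Inr j) (Inl i) (Inr k))" for i j k
    by (simp add: t_def D' C'[of i k] C'[of j k])
  have "sbracket M N $ Inr i $ Inl j = - sbracket M N $ Inr j $ Inl i" for i j
    unfolding br sum_negf[symmetric] by (rule sum.cong[OF refl]) (rule CA)
  moreover have "(\<Sum>i\<in>UNIV. sbracket M N $ Inl i $ Inl i) = 0"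
  proof -
    have AA: "(\<Sum>i\<in>UNIV. \<Sum>k\<in>UNIV. N $ Inl i $ Inl k * M $ Inl k $ Inl i)
      = (\<Sum>i\<in>UNIV. \<Sum>k\<in>UNIV. M $ Inl i $ Inl k * N $ Inl k $ Inl i)"
      by (subst sum.swap) (simp add: mult.commute)
    have BC: "(\<Sum>i\<in>UNIV. \<Sum>k\<in>UNIV. X $ Inl i $ Inr k * Y $ Inr k $ Inl i) = 0"
      if "X \<in> {M, N}" "Y \<in> {M, N}" for X Y
      using that B C by (intro sum_symmetric_skew_eq_0) blast+
    show ?thesis
      by (simp add: sbracket_nth sum_UNIV_sum sum.distrib sum_subtractf sum_negf AA BC)
  qed
  ultimately show ?thesis unfolding mem_spe_iff mem_pe_iff by blast
qed

lemma sbracket_cpe_in_spe: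
  assumes "M \<in> cpe" "N \<in> cpe"
  shows "sbracket M N \<in> spe"
  using assms sbracket_pe_in_spe
  by (auto simp: cpe_def mem_extend_by sbracket_add_zed)

lemma odd_part_cpe_in_spe:
  assumes "M \<in> cpe"
  shows "parity_part 1 M \<in> spe"
proof -
  have odd: "parity_part 1 M $ Inl i $ Inl j = 0" "parity_part 1 M $ Inr i $ Inr j = 0"
    "parity_part 1 M $ Inl i $ Inr j = M $ Inl i $ Inr j"
    "parity_part 1 M $ Inr i $ Inl j = M $ Inr i $ Inl j" for i j
    by (simp_all add: parity_part_def)
  show ?thesis
    unfolding mem_spe_iff mem_pe_iff odd minus_zero sum.neutral_const
    by (rule mem_cpe_blocks[OF assms]) blast
qed

lemma parity_parts_add: "parity_part 0 M + parity_part 1 M = M"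
  by (auto simp: parity_part_def vec_eq_iff)

lemma supersubalgebra_between:
  assumes g: "cmat.subspace g" "spe \<subseteq> g" "g \<subseteq> cpe"
  shows "supersubalgebra g"
proof -
  have "parity_part 1 M \<in> g" if "M \<in> g" for M
    using odd_part_cpe_in_spe that g by blast
  moreover from this have "parity_part 0 M \<in> g" if "M \<in> g" for M
    using cmat.subspace_diff[OF g(1) that] that parity_parts_add[of M]
    by (metis add_diff_cancel_right')
  moreover have "sbracket M N \<in> g" if "M \<in> g" "N \<in> g" for M N
    using sbracket_cpe_in_spe that g by blast
  ultimately show ?thesis
    using g(1) unfolding supersubalgebra_def by blast
qed

section \<open>Curvature maps from their values on basis vectors\<close>

definition tensor_map ::
  "('n + 'n \<Rightarrow> 'n + 'n \<Rightarrow> 'n gl) \<Rightarrow> 'n::finite sspace \<Rightarrow> 'n sspace \<Rightarrow> 'n gl" where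
  "tensor_map G X Y = (\<Sum>i\<in>UNIV. \<Sum>j\<in>UNIV. (X $ i * Y $ j) *\<^sub>C G i j)"

lemma tensor_map_nth:
  "tensor_map G X Y $ m $ k = (\<Sum>i\<in>UNIV. \<Sum>j\<in>UNIV. X $ i * Y $ j * G i j $ m $ k)"
  by (simp add: tensor_map_def)

lemma tensor_map_axis: "tensor_map G (axis i 1) (axis j 1) = G i j"
proof -
  have "tensor_map G (axis i 1) (axis j 1) $ m $ k = G i j $ m $ k" for m k
  proof -
    have "axis i 1 $ a * axis j 1 $ b * G a b $ m $ k
        = (if a = i then if b = j then G i j $ m $ k else 0 else 0)" for a b
      by (simp add: axis_def)
    then have "tensor_map G (axis i 1) (axis j 1) $ m $ k
        = (\<Sum>a\<in>UNIV. \<Sum>b\<in>UNIV. if a = i then if b = j then G i j $ m $ k else 0 else 0)"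
      unfolding tensor_map_nth by (simp only:)
    also have "\<dots> = (\<Sum>a\<in>UNIV. if a = i then \<Sum>b\<in>UNIV. if b = j then G i j $ m $ k else 0 else 0)"
      by (intro sum.cong refl) simp
    finally show ?thesis by simp
  qed
  then show ?thesis by (simp add: vec_eq_iff)
qed

lemma bilinear_tensor_map: "bilinear_map (tensor_map G)"
proof -
  have "Vector_Spaces.linear (*s) (*\<^sub>C) (\<lambda>Y. tensor_map G X Y)" for X
    by unfold_locales
      (simp_all add: vec_eq_iff tensor_map_nth algebra_simps sum.distrib sum_distrib_left)
  moreover have "Vector_Spaces.linear (*s) (*\<^sub>C) (\<lambda>X. tensor_map G X Y)" for Y
    by unfold_locales
      (simp_all add: vec_eq_iff tensor_map_nth algebra_simps sum.distrib sum_distrib_left)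
  ultimately show ?thesis unfolding bilinear_map_def by blast
qed

text \<open>
  Homogeneity turns the parities of the arguments into parities of indices: the terms where
  the two disagree vanish.
\<close>

lemma tensor_map_in_curvature_maps:
  fixes G :: "'n + 'n \<Rightarrow> 'n + 'n \<Rightarrow> 'n::finite gl"
  assumes g: "cmat.subspace g"
    and mem: "\<And>i j. G i j \<in> g"
    and skew: "\<And>i j. G i j = - ((-1) ^ (par i * par j) *\<^sub>C G j i)"
    and bianchi: "\<And>i j k m. G i j $ m $ k + (-1) ^ (par i * (par j + par k)) * G j k $ m $ i
      + (-1) ^ (par k * (par i + par j)) * G k i $ m $ j = 0"
  shows "tensor_map G \<in> curvature_maps g"
proof -
  have 1: "tensor_map G X Y \<in> g" for X Y
    unfolding tensor_map_def
    by (intro cmat.subspace_sum[OF g] cmat.subspace_scale[OF g] mem)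
  have 2: "tensor_map G X Y = - ((-1) ^ (p * q) *\<^sub>C tensor_map G Y X)"
    if "homogeneous p X" "homogeneous q Y" for p q X Y
  proof -
    have "tensor_map G X Y $ m $ k = - ((-1) ^ (p * q) * tensor_map G Y X $ m $ k)" for m k
    proof -
      have "X $ i * Y $ j * G i j $ m $ k = - ((-1) ^ (p * q) * (Y $ j * X $ i * G j i $ m $ k))"
        for i j
      proof (cases "par i = p \<and> par j = q")
        case True
        then show ?thesis by (subst skew) simp
      qed (use that in \<open>auto simp: homogeneous_def\<close>)
      then have "tensor_map G X Y $ m $ k
        = (\<Sum>i\<in>UNIV. \<Sum>j\<in>UNIV. - ((-1) ^ (p * q) * (Y $ j * X $ i * G j i $ m $ k)))"
        by (simp add: tensor_map_nth)
      also have "\<dots> = - ((-1) ^ (p * q) * tensor_map G Y X $ m $ k)"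
        unfolding tensor_map_nth sum_distrib_left sum_negf[symmetric] by (rule sum.swap)
      finally show ?thesis .
    qed
    then show ?thesis by (simp add: vec_eq_iff)
  qed
  have 3: "tensor_map G X Y *v Z + (-1) ^ (p * (q + r)) *s (tensor_map G Y Z *v X)
      + (-1) ^ (r * (p + q)) *s (tensor_map G Z X *v Y) = 0"
    if h: "homogeneous p X" "homogeneous q Y" "homogeneous r Z" for p q r X Y Z
  proof -
    have act: "(tensor_map G X Y *v Z) $ m
      = (\<Sum>k\<in>UNIV. \<Sum>i\<in>UNIV. \<Sum>j\<in>UNIV. X $ i * Y $ j * Z $ k * G i j $ m $ k)" for X Y Z m
      unfolding matrix_vector_mult_def tensor_map_nth
      by (simp add: sum_distrib_left mult_ac)
    have act1: "(tensor_map G X Y *v Z) $ m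
      = (\<Sum>i\<in>UNIV. \<Sum>j\<in>UNIV. \<Sum>k\<in>UNIV. X $ i * Y $ j * Z $ k * G i j $ m $ k)" for m
      unfolding act by (subst sum.swap, rule sum.cong[OF refl], rule sum.swap)
    have act2: "(tensor_map G Y Z *v X) $ m
      = (\<Sum>i\<in>UNIV. \<Sum>j\<in>UNIV. \<Sum>k\<in>UNIV. X $ i * Y $ j * Z $ k * G j k $ m $ i)" for m
      unfolding act by (simp add: mult_ac)
    have act3: "(tensor_map G Z X *v Y) $ m
      = (\<Sum>i\<in>UNIV. \<Sum>j\<in>UNIV. \<Sum>k\<in>UNIV. X $ i * Y $ j * Z $ k * G k i $ m $ j)" for m
    proof -
      have "(tensor_map G Z X *v Y) $ m
        = (\<Sum>j\<in>UNIV. \<Sum>k\<in>UNIV. \<Sum>i\<in>UNIV. X $ i * Y $ j * Z $ k * G k i $ m $ j)"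
        unfolding act by (simp add: mult_ac)
      also have "\<dots> = (\<Sum>j\<in>UNIV. \<Sum>i\<in>UNIV. \<Sum>k\<in>UNIV. X $ i * Y $ j * Z $ k * G k i $ m $ j)"
        by (rule sum.cong[OF refl], rule sum.swap)
      also have "\<dots> = (\<Sum>i\<in>UNIV. \<Sum>j\<in>UNIV. \<Sum>k\<in>UNIV. X $ i * Y $ j * Z $ k * G k i $ m $ j)"
        by (rule sum.swap)
      finally show ?thesis .
    qed
    have "X $ i * Y $ j * Z $ k * G i j $ m $ k
        + (-1) ^ (p * (q + r)) * (X $ i * Y $ j * Z $ k * G j k $ m $ i)
        + (-1) ^ (r * (p + q)) * (X $ i * Y $ j * Z $ k * G k i $ m $ j) = 0" for i j k m
    proof (cases "par i = p \<and> par j = q \<and> par k = r")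
      case True
      have "X $ i * Y $ j * Z $ k * (G i j $ m $ k
        + (-1) ^ (par i * (par j + par k)) * G j k $ m $ i
        + (-1) ^ (par k * (par i + par j)) * G k i $ m $ j) = 0"
        unfolding bianchi by simp
      with True show ?thesis by (simp add: algebra_simps)
    qed (use h in \<open>auto simp: homogeneous_def\<close>)
    then show ?thesis
      by (simp add: vec_eq_iff act1 act2 act3 sum_distrib_left flip: sum.distrib)
  qed
  show ?thesis
    unfolding curvature_maps_def using bilinear_tensor_map[of G] 1 2 3 by blast
qed

section \<open>Squares of two-forms\<close>

definition wedge :: "'n \<Rightarrow> 'n \<Rightarrow> 'n \<Rightarrow> 'n \<Rightarrow> complex" where
  "wedge p q i j = of_bool (i = p) * of_bool (j = q) - of_bool (i = q) * of_bool (j = p)"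

lemma wedge_skew: "wedge p q i j = - wedge p q j i"
  by (simp add: wedge_def)

lemma wedge_same [simp]: "wedge p q i i = 0"
  by (simp add: wedge_def)

text \<open>
  The Pluecker relation, the equation expressing that \<open>e\<^sup>p \<and> e\<^sup>q\<close> is decomposable.
\<close>

lemma wedge_pluecker:
  "wedge p q i j * wedge p q m k + wedge p q j k * wedge p q m i + wedge p q k i * wedge p q m j = 0"
  by (simp add: wedge_def algebra_simps)

fun lower_tensor :: "'n \<Rightarrow> 'n \<Rightarrow> 'n + 'n \<Rightarrow> 'n + 'n \<Rightarrow> 'n::finite gl" where
  "lower_tensor p q (Inl i) (Inl j) = wedge p q i j *\<^sub>C lower_block (wedge p q)"
| "lower_tensor p q (Inl i) (Inr j) = 0"
| "lower_tensor p q (Inr i) (Inl j) = 0"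
| "lower_tensor p q (Inr i) (Inr j) = 0"

fun upper_tensor :: "'n \<Rightarrow> 'n \<Rightarrow> 'n + 'n \<Rightarrow> 'n + 'n \<Rightarrow> 'n::finite gl" where
  "upper_tensor p q (Inl i) (Inl j) = 0"
| "upper_tensor p q (Inl i) (Inr j) = 0"
| "upper_tensor p q (Inr i) (Inl j) = 0"
| "upper_tensor p q (Inr i) (Inr j) =
     upper_block (\<lambda>k l. wedge p q i k * wedge p q j l + wedge p q i l * wedge p q j k)"

lemma lower_block_in_spe:
  assumes "\<And>i j. C i j = - C j i"
  shows "lower_block C \<in> spe"
  unfolding mem_spe_iff mem_pe_iff blocks_nth by (auto intro: assms)

lemma upper_block_in_spe:
  assumes "\<And>i j. B i j = B j i"
  shows "upper_block B \<in> spe"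
  unfolding mem_spe_iff mem_pe_iff blocks_nth by (auto intro: assms)

lemma diagonal_blocks_in_spe:
  assumes "(\<Sum>i\<in>UNIV. A i i) = 0"
  shows "diagonal_blocks A (\<lambda>i j. - A j i) \<in> spe"
  unfolding mem_spe_iff mem_pe_iff blocks_nth by (auto intro: assms)

lemma tensor_map_lower_tensor:
  assumes g: "cmat.subspace g" "spe \<subseteq> g"
  shows "tensor_map (lower_tensor p q) \<in> curvature_maps g"
proof (rule tensor_map_in_curvature_maps[OF g(1)])
  show "lower_tensor p q i j \<in> g" for i j
    using lower_block_in_spe[of "wedge p q", OF wedge_skew] g cmat.subspace_scale[OF g(1)]
      cmat.subspace_0[OF g(1)]
    by (cases i; cases j) auto
  show "lower_tensor p q i j = - ((-1) ^ (par i * par j) *\<^sub>C lower_tensor p q j i)" for i j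
  proof (cases i; cases j)
    fix i' j' assume ij: "i = Inl i'" "j = Inl j'"
    show ?thesis
      unfolding ij using wedge_skew[of p q i' j'] by (auto intro: gl_eqI)
  qed simp_all
  show "lower_tensor p q i j $ m $ k
      + (-1) ^ (par i * (par j + par k)) * lower_tensor p q j k $ m $ i
      + (-1) ^ (par k * (par i + par j)) * lower_tensor p q k i $ m $ j = 0" for i j k m
    by (cases i; cases j; cases k; cases m) (simp_all add: wedge_pluecker)
qed

lemma tensor_map_upper_tensor:
  assumes g: "cmat.subspace g" "spe \<subseteq> g"
  shows "tensor_map (upper_tensor p q) \<in> curvature_maps g"
proof (rule tensor_map_in_curvature_maps[OF g(1)])
  show "upper_tensor p q i j \<in> g" for i j
  proof (cases i; cases j)
    fix i' j' assume ij: "i = Inr i'" "j = Inr j'"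
    show ?thesis
      unfolding ij upper_tensor.simps
      using g(2) by (rule subsetD) (rule upper_block_in_spe, simp)
  qed (simp_all add: cmat.subspace_0[OF g(1)])
  show "upper_tensor p q i j = - ((-1) ^ (par i * par j) *\<^sub>C upper_tensor p q j i)" for i j
    by (cases i; cases j) (auto intro!: gl_eqI)
  \<comment> \<open>Skewness suffices: each product occurs twice, with opposite signs.\<close>
  have cyclic: "w i m * w j k + w i k * w j m + (w j m * w k i + w j i * w k m)
      + (w k m * w i j + w k j * w i m) = 0"
    if "\<And>i j. w i j = - w j i" for w :: "'a \<Rightarrow> 'a \<Rightarrow> complex" and i j k m
    using that[of i j] that[of j k] that[of k i] by (simp add: algebra_simps)
  show "upper_tensor p q i j $ m $ k
      + (-1) ^ (par i * (par j + par k)) * upper_tensor p q j k $ m $ i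
      + (-1) ^ (par k * (par i + par j)) * upper_tensor p q k i $ m $ j = 0" for i j k m
    by (cases i; cases j; cases k; cases m)
      (simp_all add: cyclic[of "wedge p q", OF wedge_skew])
qed

section \<open>Curvature maps with a prescribed even value\<close>

text \<open>
  A tensor \<open>\<rho>\<close> of the form \<open>(u \<and> v) \<otimes> a - (v \<and> x) \<otimes> u - (y \<and> u) \<otimes> v\<close>, where \<open>u\<close>, \<open>v\<close> are
  the coordinates number \<open>p\<close> and \<open>q\<close>, \<open>a\<^sub>k = A e\<^sub>k\<close>, and \<open>x\<close>, \<open>y\<close> split \<open>a\<close> outside \<open>p\<close> and \<open>q\<close>:
  \<open>x\<^sub>k\<close> is the component of \<open>a\<^sub>k\<close> along \<open>e\<^sub>q\<close> and \<open>y\<^sub>k\<close> the rest, with \<open>x\<^sub>p = 0\<close> and \<open>y\<^sub>q = 0\<close>.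
  The index \<open>l\<close> is the component of the vector-valued tensor.
\<close>

definition corrected_tensor :: "'n \<Rightarrow> 'n \<Rightarrow> ('n \<Rightarrow> 'n \<Rightarrow> complex) \<Rightarrow> 'n \<Rightarrow> 'n \<Rightarrow> 'n \<Rightarrow> 'n \<Rightarrow> complex" where
  "corrected_tensor p q A l i j k = wedge p q i j * A l k
     - (if l = q then of_bool (i = q) * (of_bool (j \<noteq> p) * A l j)
                    - of_bool (j = q) * (of_bool (i \<noteq> p) * A l i) else 0) * of_bool (k = p)
     - (if l = q then 0 else of_bool (i \<noteq> q) * A l i * of_bool (j = p)
                    - of_bool (j \<noteq> q) * A l j * of_bool (i = p)) * of_bool (k = q)"

lemma corrected_tensor_skew: "corrected_tensor p q A l i j k = - corrected_tensor p q A l j i k"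
  unfolding corrected_tensor_def wedge_skew[of p q i j] by (simp add: algebra_simps)

text \<open>
  The cyclic sum is \<open>u \<and> v \<and> (a - x - y)\<close>, and \<open>a - x - y\<close> vanishes outside \<open>p\<close> and \<open>q\<close>, so it
  is a combination of \<open>u\<close> and \<open>v\<close>.
\<close>

lemma corrected_tensor_cyclic:
  assumes "p \<noteq> q"
  shows "corrected_tensor p q A l i j k + corrected_tensor p q A l j k i + corrected_tensor p q A l k i j = 0"
proof -
  define u v where "u i = (of_bool (i = p) :: complex)" and "v i = (of_bool (i = q) :: complex)" for i
  define x y where "x k = (if l = q then of_bool (k \<noteq> p) * A l k else 0)"
    and "y k = (if l = q then 0 else of_bool (k \<noteq> q) * A l k)" for k
  define s t where "s = A l p - x p - y p" and "t = A l q - x q - y q"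
  have corrected_tensor: "corrected_tensor p q A l i j k = (u i * v j - v i * u j) * A l k
      - (v i * x j - v j * x i) * u k - (y i * u j - y j * u i) * v k" for i j k
    unfolding corrected_tensor_def wedge_def u_def v_def x_def y_def by simp
  have A: "A l k = x k + y k + s * u k + t * v k" for k
    using assms by (auto simp: s_def t_def u_def v_def x_def y_def)
  show ?thesis
    unfolding corrected_tensor A by (simp add: algebra_simps)
qed

lemma corrected_tensor_at: "p \<noteq> q \<Longrightarrow> corrected_tensor p q A l p q k = A l k"
  by (simp add: corrected_tensor_def wedge_def)

text \<open>
  The correction terms are traceless, because \<open>x\<close> has no component along \<open>e\<^sub>p\<close> and \<open>y\<close> none along
  \<open>e\<^sub>q\<close>.  This keeps all values of the curvature map within \<open>spe + \<langle>M\<rangle>\<close>.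
\<close>

lemma corrected_tensor_diagonal: "p \<noteq> q \<Longrightarrow> corrected_tensor p q A l i j l = wedge p q i j * A l l"
  by (simp add: corrected_tensor_def)

text \<open>
  The matrix of \<open>R(e\<^sub>j, f\<^sub>l)\<close>, with row \<open>k\<close> and column \<open>i\<close>.  It is the solution \<open>K\<close>, skew in \<open>k\<close> and \<open>i\<close>,
  of the Bianchi identity \<open>K\<^sub>j\<^sub>k\<^sub>i - K\<^sub>i\<^sub>k\<^sub>j = \<rho>\<^sub>i\<^sub>j\<^sub>k - 2 c w\<^sub>i\<^sub>j \<delta>\<^sub>k\<^sub>l\<close>.  The summand with \<open>\<rho>\<close> accounts for the
  first term on the right by the cyclic identity, and the multiple of \<open>c\<close> for the second.
\<close>

definition mixed_coeff ::
  "'n \<Rightarrow> 'n \<Rightarrow> ('n \<Rightarrow> 'n \<Rightarrow> complex) \<Rightarrow> complex \<Rightarrow> 'n \<Rightarrow> 'n \<Rightarrow> 'n \<Rightarrow> 'n \<Rightarrow> complex" where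
  "mixed_coeff p q A c l j k i = corrected_tensor p q A l i k j + c * (wedge p q k i * of_bool (j = l)
     + wedge p q j i * of_bool (k = l) + wedge p q k j * of_bool (i = l))"

fun even_tensor ::
  "'n \<Rightarrow> 'n \<Rightarrow> ('n \<Rightarrow> 'n \<Rightarrow> complex) \<Rightarrow> complex \<Rightarrow> 'n + 'n \<Rightarrow> 'n + 'n \<Rightarrow> 'n::finite gl" where
  "even_tensor p q A c (Inl i) (Inl j) = diagonal_blocks (\<lambda>l k. corrected_tensor p q A l i j k)
     (\<lambda>k l. - corrected_tensor p q A l i j k + 2 * c * wedge p q i j * of_bool (k = l))"
| "even_tensor p q A c (Inl j) (Inr l) = lower_block (mixed_coeff p q A c l j)"
| "even_tensor p q A c (Inr l) (Inl j) = - lower_block (mixed_coeff p q A c l j)"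
| "even_tensor p q A c (Inr i) (Inr j) = 0"

lemma mixed_coeff_skew: "mixed_coeff p q A c l j k i = - mixed_coeff p q A c l j i k"
  unfolding mixed_coeff_def
  using corrected_tensor_skew[of p q A l i k j] wedge_skew[of p q k i] wedge_skew[of p q j i]
    wedge_skew[of p q k j] by (simp add: algebra_simps)

lemma mixed_coeff_bianchi:
  assumes "p \<noteq> q"
  shows "mixed_coeff p q A c l j k i - mixed_coeff p q A c l i k j
    = corrected_tensor p q A l i j k - 2 * c * wedge p q i j * of_bool (k = l)"
proof -
  have jki: "corrected_tensor p q A l j k i = - corrected_tensor p q A l i j k - corrected_tensor p q A l k i j"
    using corrected_tensor_cyclic[OF assms, of A l i j k] by algebra
  show ?thesis
    unfolding mixed_coeff_def jki corrected_tensor_skew[of p q A l i k j] wedge_skew[of p q j i]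
    by (simp add: algebra_simps)
qed

text \<open>
  Each \<open>R(e\<^sub>i, e\<^sub>j)\<close> is \<open>(u \<and> v)\<^sub>i\<^sub>j M\<close> plus a traceless block-diagonal element of \<open>spe\<close>, and each
  \<open>R(e\<^sub>j, f\<^sub>l)\<close> is a lower left block.  As \<open>R(f\<^sub>i, f\<^sub>j) = 0\<close> and lower left blocks annihilate the odd
  vectors, the Bianchi identity is nontrivial only when at most one of its three arguments is odd.
\<close>

lemma tensor_map_even_tensor:
  assumes g: "cmat.subspace g" "spe \<subseteq> g" and "p \<noteq> q"
    and M: "diagonal_blocks A (\<lambda>k l. - A l k + 2 * c * of_bool (k = l)) \<in> g" (is "?M \<in> g")
  shows "tensor_map (even_tensor p q A c) \<in> curvature_maps g"
proof (rule tensor_map_in_curvature_maps[OF g(1)])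
  have ll: "even_tensor p q A c (Inl i) (Inl j) \<in> g" for i j
  proof -
    define A' where "A' l k = corrected_tensor p q A l i j k - wedge p q i j * A l k" for l k
    have "diagonal_blocks A' (\<lambda>k l. - A' l k) \<in> g"
      using g(2) by (rule subsetD)
        (rule diagonal_blocks_in_spe, simp add: A'_def corrected_tensor_diagonal[OF \<open>p \<noteq> q\<close>])
    moreover have "even_tensor p q A c (Inl i) (Inl j)
        = diagonal_blocks A' (\<lambda>k l. - A' l k) + wedge p q i j *\<^sub>C ?M"
      by (rule gl_eqI) (simp_all add: A'_def algebra_simps)
    ultimately show ?thesis
      using cmat.subspace_add[OF g(1) _ cmat.subspace_scale[OF g(1) M]] by simp
  qed
  have lr: "lower_block (mixed_coeff p q A c l j) \<in> g" for j l
    using lower_block_in_spe[of "mixed_coeff p q A c l j", OF mixed_coeff_skew] g(2) by blast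
  show "even_tensor p q A c i j \<in> g" for i j
    using ll lr cmat.subspace_neg[OF g(1) lr] cmat.subspace_0[OF g(1)]
    by (cases i; cases j) (auto simp del: even_tensor.simps(1))
  show "even_tensor p q A c i j = - ((-1) ^ (par i * par j) *\<^sub>C even_tensor p q A c j i)" for i j
  proof (cases i; cases j)
    fix i' j' assume ij: "i = Inl i'" "j = Inl j'"
    have "corrected_tensor p q A l i' j' k = - corrected_tensor p q A l j' i' k" for l k
      by (rule corrected_tensor_skew)
    then show ?thesis
      unfolding ij using wedge_skew[of p q i' j'] by (intro gl_eqI) (simp_all add: algebra_simps)
  qed (auto simp del: even_tensor.simps(1))
  show "even_tensor p q A c i j $ m $ k
      + (-1) ^ (par i * (par j + par k)) * even_tensor p q A c j k $ m $ i
      + (-1) ^ (par k * (par i + par j)) * even_tensor p q A c k i $ m $ j = 0" for i j k m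
  proof (cases i; cases j; cases k; cases m)
    fix i' j' k' m'
    show ?thesis if "i = Inl i'" "j = Inl j'" "k = Inl k'" "m = Inl m'"
      unfolding that using corrected_tensor_cyclic[OF \<open>p \<noteq> q\<close>] by simp
    show ?thesis if "i = Inl i'" "j = Inl j'" "k = Inr k'" "m = Inr m'"
      unfolding that using mixed_coeff_bianchi[OF \<open>p \<noteq> q\<close>, of A c k' j' m' i']
      by (simp add: algebra_simps)
    show ?thesis if "i = Inl i'" "j = Inr j'" "k = Inl k'" "m = Inr m'"
      unfolding that using mixed_coeff_bianchi[OF \<open>p \<noteq> q\<close>, of A c j' i' m' k']
      by (simp add: algebra_simps)
    show ?thesis if "i = Inr i'" "j = Inl j'" "k = Inl k'" "m = Inr m'"
      unfolding that using mixed_coeff_bianchi[OF \<open>p \<noteq> q\<close>, of A c i' k' m' j']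
      by (simp add: algebra_simps)
  qed simp_all
qed

section \<open>The span of the curvature maps\<close>

lemma curvature_spanI: "R \<in> curvature_maps g \<Longrightarrow> R X Y \<in> curvature_span g"
  unfolding curvature_span_def by (rule cmat.span_base) blast

lemma tensor_value_in_curvature_span:
  "tensor_map G \<in> curvature_maps g \<Longrightarrow> G i j \<in> curvature_span g"
  using curvature_spanI[of "tensor_map G" g "axis i 1" "axis j 1"] by (simp add: tensor_map_axis)

lemma subspace_curvature_span: "cmat.subspace (curvature_span g)"
  unfolding curvature_span_def by (rule cmat.subspace_span)

lemma curvature_span_subset:
  assumes "cmat.subspace g"
  shows "curvature_span g \<subseteq> g"
  unfolding curvature_span_def
  by (rule cmat.span_minimal[OF _ assms]) (auto simp: curvature_maps_def)

lemma sum_double_delta: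
  fixes f :: "'a::finite \<Rightarrow> 'a \<Rightarrow> complex"
  shows "(\<Sum>k\<in>UNIV. \<Sum>l\<in>UNIV. f k l * (of_bool (i = k) * of_bool (j = l))) = f i j"
    and "(\<Sum>k\<in>UNIV. \<Sum>l\<in>UNIV. f k l * (of_bool (i = l) * of_bool (j = k))) = f j i"
proof -
  have *: "(\<Sum>k\<in>UNIV. \<Sum>l\<in>UNIV. f k l * (of_bool (i = k) * of_bool (j = l))) = f i j" for i j
  proof -
    have "(\<Sum>k\<in>UNIV. \<Sum>l\<in>UNIV. f k l * (of_bool (i = k) * of_bool (j = l)))
        = (\<Sum>k\<in>UNIV. if i = k then \<Sum>l\<in>UNIV. if j = l then f k l else 0 else 0)"
      by (intro sum.cong refl) (auto intro!: sum.cong)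
    then show ?thesis by simp
  qed
  show "(\<Sum>k\<in>UNIV. \<Sum>l\<in>UNIV. f k l * (of_bool (i = k) * of_bool (j = l))) = f i j"
    by (rule *)
  show "(\<Sum>k\<in>UNIV. \<Sum>l\<in>UNIV. f k l * (of_bool (i = l) * of_bool (j = k))) = f j i"
    using *[of j i] by (simp only: mult.commute)
qed

lemma lower_block_in_curvature_span:
  assumes g: "cmat.subspace g" "spe \<subseteq> g" and C: "\<And>i j. C i j = - C j i"
  shows "lower_block C \<in> curvature_span g"
proof -
  note S = subspace_curvature_span[of g]
  have "lower_block (wedge k l) \<in> curvature_span g" for k l
  proof (cases "k = l")
    case True
    then have "lower_block (wedge k l) = 0"
      by (intro gl_eqI) (simp_all add: wedge_def)
    then show ?thesis using cmat.subspace_0[OF S] by simp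
  next
    case False
    then have "lower_tensor k l (Inl k) (Inl l) = lower_block (wedge k l)"
      by (simp add: wedge_def)
    then show ?thesis
      using tensor_value_in_curvature_span[OF tensor_map_lower_tensor[OF g]] by metis
  qed
  then have "(\<Sum>k\<in>UNIV. \<Sum>l\<in>UNIV. (C k l / 2) *\<^sub>C lower_block (wedge k l)) \<in> curvature_span g"
    by (intro cmat.subspace_sum[OF S] cmat.subspace_scale[OF S])
  moreover have "(\<Sum>k\<in>UNIV. \<Sum>l\<in>UNIV. (C k l / 2) *\<^sub>C lower_block (wedge k l)) = lower_block C"
  proof (rule gl_eqI)
    fix i j
    have "(\<Sum>k\<in>UNIV. \<Sum>l\<in>UNIV. C k l / 2 * wedge k l i j) = C i j / 2 - C j i / 2"
      by (simp only: wedge_def right_diff_distrib sum_subtractf sum_double_delta)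
    then show "(\<Sum>k\<in>UNIV. \<Sum>l\<in>UNIV. (C k l / 2) *\<^sub>C lower_block (wedge k l)) $ Inr i $ Inl j
        = lower_block C $ Inr i $ Inl j"
      using C[of j i] by simp
  qed simp_all
  ultimately show ?thesis by simp
qed

lemma ex_neq:
  assumes "CARD('n::finite) \<ge> 2"
  shows "\<exists>q. q \<noteq> (k :: 'n)"
proof (rule ccontr)
  assume "\<not> ?thesis"
  then have "(UNIV :: 'n set) = {k}" by auto
  then have "CARD('n) = card {k}" by (rule arg_cong)
  with assms show False by simp
qed

lemma upper_block_in_curvature_span:
  fixes g :: "'n::finite gl set"
  assumes g: "cmat.subspace g" "spe \<subseteq> g" and B: "\<And>i j. B i j = B j i" and n: "CARD('n) \<ge> 2"
  shows "upper_block B \<in> curvature_span g"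
proof -
  note S = subspace_curvature_span[of g]
  define E where "E k l = upper_block
    (\<lambda>i j. of_bool (i = k) * of_bool (j = l) + of_bool (i = l) * of_bool (j = k))" for k l :: 'n
  have "E k l \<in> curvature_span g" for k l
  proof (cases "k = l")
    case True
    obtain q where "q \<noteq> k" using ex_neq[OF n] by blast
    \<comment> \<open>The values at \<open>(f\<^sub>q, f\<^sub>q)\<close> give the diagonal part, those at \<open>(f\<^sub>k, f\<^sub>l)\<close> the rest.\<close>
    then have "upper_tensor k q (Inr q) (Inr q) = E k l"
      using True by (intro gl_eqI) (simp_all add: E_def wedge_def)
    then show ?thesis
      using tensor_value_in_curvature_span[OF tensor_map_upper_tensor[OF g]] by metis
  next
    case False
    then have "upper_tensor k l (Inr k) (Inr l) = - E k l"
      by (intro gl_eqI) (simp_all add: E_def wedge_def)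
    then show ?thesis
      using tensor_value_in_curvature_span[OF tensor_map_upper_tensor[OF g]]
        cmat.subspace_neg[OF S] by (metis add.inverse_inverse)
  qed
  then have "(\<Sum>k\<in>UNIV. \<Sum>l\<in>UNIV. (B k l / 2) *\<^sub>C E k l) \<in> curvature_span g"
    by (intro cmat.subspace_sum[OF S] cmat.subspace_scale[OF S])
  moreover have "(\<Sum>k\<in>UNIV. \<Sum>l\<in>UNIV. (B k l / 2) *\<^sub>C E k l) = upper_block B"
  proof (rule gl_eqI)
    fix i j
    have "(\<Sum>k\<in>UNIV. \<Sum>l\<in>UNIV. B k l / 2 *
        (of_bool (i = k) * of_bool (j = l) + of_bool (i = l) * of_bool (j = k)))
      = B i j / 2 + B j i / 2"
      by (simp only: distrib_left sum.distrib sum_double_delta)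
    then show "(\<Sum>k\<in>UNIV. \<Sum>l\<in>UNIV. (B k l / 2) *\<^sub>C E k l) $ Inl i $ Inr j
        = upper_block B $ Inl i $ Inr j"
      using B[of j i] by (simp add: E_def)
  qed (simp_all add: E_def)
  ultimately show ?thesis by simp
qed

lemma berger_between:
  fixes g :: "'n::finite gl set"
  assumes n: "CARD('n) \<ge> 2" and g: "cmat.subspace g" "spe \<subseteq> g" "g \<subseteq> cpe"
  shows "berger g"
proof -
  note S = subspace_curvature_span[of g]
  have sub: "supersubalgebra g"
    using supersubalgebra_between[OF g] .
  have "M \<in> curvature_span g" if M: "M \<in> g" for M
  proof -
    obtain c where D: "\<And>i j. M $ Inr i $ Inr j = - M $ Inl j $ Inl i + (if i = j then 2 * c else 0)"
      and B: "\<And>i j. M $ Inl i $ Inr j = M $ Inl j $ Inr i"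
      and C: "\<And>i j. M $ Inr i $ Inl j = - M $ Inr j $ Inl i"
      by (rule mem_cpe_blocks[OF subsetD[OF g(3) M]]) blast
    define A where "A i j = M $ Inl i $ Inl j" for i j
    let ?M0 = "diagonal_blocks A (\<lambda>k l. - A l k + 2 * c * of_bool (k = l))"
    have "parity_part 0 M = ?M0"
      by (rule gl_eqI) (simp_all add: parity_part_def A_def D)
    then have M0: "?M0 \<in> g"
      using sub M unfolding supersubalgebra_def by (metis insertI1)
    obtain p q :: 'n where pq: "p \<noteq> q" using ex_neq[OF n] by metis
    have "even_tensor p q A c (Inl p) (Inl q) = ?M0"
      using pq by (intro gl_eqI) (simp_all add: corrected_tensor_at wedge_def)
    then have D': "?M0 \<in> curvature_span g"
      using tensor_value_in_curvature_span[OF tensor_map_even_tensor[OF g(1,2) pq M0]] by metis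
    have B': "upper_block (\<lambda>i j. M $ Inl i $ Inr j) \<in> curvature_span g"
      by (rule upper_block_in_curvature_span[OF g(1,2) B n])
    have C': "lower_block (\<lambda>i j. M $ Inr i $ Inl j) \<in> curvature_span g"
      by (rule lower_block_in_curvature_span[OF g(1,2) C])
    have "M = ?M0 + upper_block (\<lambda>i j. M $ Inl i $ Inr j)
        + lower_block (\<lambda>i j. M $ Inr i $ Inl j)"
      by (rule gl_eqI) (simp_all add: A_def D)
    also have "\<dots> \<in> curvature_span g"
      by (intro cmat.subspace_add[OF S] D' B' C')
    finally show ?thesis .
  qed
  then show ?thesis
    unfolding berger_def using sub curvature_span_subset[OF g(1)] by blast
qed

lemma pe_subset_cpe: "pe \<subseteq> cpe"
  unfolding cpe_def by (rule subset_extend_by)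

lemma subspace_cpe: "cmat.subspace cpe"
  unfolding cpe_def by (rule subspace_extend_by[OF subspace_pe])

lemma tau_zed_in_cpe: "a *\<^sub>C tau + b *\<^sub>C zed \<in> (cpe :: 'n::finite gl set)"
proof -
  have "tau \<in> (pe :: 'n gl set)"
    by (auto simp: mem_pe_iff tau_def)
  then show ?thesis
    unfolding cpe_def mem_extend_by using cmat.subspace_scale[OF subspace_pe] by blast
qed

lemma berger_extend_spe:
  assumes "CARD('n::finite) \<ge> 2"
  shows "berger (extend_by spe (a *\<^sub>C tau + b *\<^sub>C zed) :: 'n gl set)"
proof (rule berger_between[OF assms subspace_extend_by[OF subspace_spe] subset_extend_by])
  show "extend_by spe (a *\<^sub>C tau + b *\<^sub>C zed) \<subseteq> (cpe :: 'n gl set)"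
  proof
    fix X :: "'n gl" assume "X \<in> extend_by spe (a *\<^sub>C tau + b *\<^sub>C zed)"
    then obtain Y c where "Y \<in> spe" and X: "X = Y + c *\<^sub>C (a *\<^sub>C tau + b *\<^sub>C zed)"
      by (auto simp: mem_extend_by)
    then have "Y \<in> cpe" using spe_subset_pe pe_subset_cpe by blast
    then show "X \<in> cpe"
      unfolding X by (intro cmat.subspace_add cmat.subspace_scale subspace_cpe tau_zed_in_cpe)
  qed
qed

theorem proposition12p2:
  assumes "CARD('n::finite) \<ge> 3"
  shows "berger (spe :: 'n gl set) \<and>
    berger (pe :: 'n gl set) \<and>
    berger (cspe :: 'n gl set) \<and>
    berger (cpe :: 'n gl set) \<and>
    berger (extend_by spe (tau + of_nat CARD('n) *\<^sub>C zed) :: 'n gl set) \<and>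
    (\<forall>a b :: complex. a \<noteq> 0 \<longrightarrow> b / a \<noteq> of_nat CARD('n) \<longrightarrow>
       berger (extend_by spe (a *\<^sub>C tau + b *\<^sub>C zed) :: 'n gl set))"
proof -
  have n: "CARD('n) \<ge> 2" using assms by simp
  note between = berger_between[OF n]
  have "berger (spe :: 'n gl set)"
    using spe_subset_pe pe_subset_cpe by (intro between subspace_spe) auto
  moreover have "berger (pe :: 'n gl set)"
    by (intro between subspace_pe spe_subset_pe pe_subset_cpe)
  moreover have "berger (cpe :: 'n gl set)"
    using spe_subset_pe pe_subset_cpe by (intro between subspace_cpe) auto
  moreover have "berger (cspe :: 'n gl set)"
    using berger_extend_spe[OF n, of 0 1] by (simp add: cspe_def)
  moreover have "berger (extend_by spe (tau + of_nat CARD('n) *\<^sub>C zed) :: 'n gl set)"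
    using berger_extend_spe[OF n, of 1 "of_nat CARD('n)"] by simp
  ultimately show ?thesis
    using berger_extend_spe[OF n] by blast
qed

end
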